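(* Let $\mathbb{X}$ be a non-degenerate set of $s$ points in generic position in $\mathbb{P}^{n_1}\times\cdots\times\mathbb{P}^{n_k}$, and set $$v(s;n_1,\ldots,n_k):=\sum_{\underline{i}\in\mathcal{D}}(N(\underline{i})-s)+\sum_{\underline{j}\in\mathbb{D}}\max\Big\{0,\ N(\underline{j})-s-\sum_{l\in L_{\underline{j}}}(n_l+1)\big(N(\underline{j}-e_l)-s\big)\Big\},$$ with $\mathcal{D}$, $\mathbb{D}$, $L_{\underline{j}}$ as defined in the context. Then $\nu(I_{\mathbb{X}})\ge v(s;n_1,\ldots,n_k)$.
   Context: $\mathbf{k}$ is an algebraically closed field of characteristic $0$; $\mathbb{N}=\{0,1,2,\ldots\}$; $k\ge 1$ and $n_1,\ldots,n_k\ge 1$ are integers; $[k]=\{1,\ldots,k\}$; $e_1,\ldots,e_k$ is the standard basis of $\mathbb{N}^k$; $\mathbb{N}^k$ is partially ordered coordinatewise, and $\min\mathcal{S}$ denotes the set of minimal elements of $\mathcal{S}\subseteq\mathbb{N}^k$. $R=\mathbf{k}[x_{l,m} : 1\le l\le k,\ 0\le m\le n_l]$ is $\mathbb{N}^k$-graded by $\deg x_{l,m}=e_l$; it is the coordinate ring of $\mathbb{P}^{n_1}\times\cdots\times\mathbb{P}^{n_k}$ over $\mathbf{k}$. $N(\underline{i})=\dim_{\mathbf{k}}R_{\underline{i}}=\prod_{l=1}^k\binom{n_l+i_l}{i_l}$. For a nonempty finite set $\mathbb{X}$ of points, $I_{\mathbb{X}}\subseteq R$ is the ideal generated by the $\mathbb{N}^k$-homogeneous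 forms vanishing at every point of $\mathbb{X}$, $H_{\mathbb{X}}(\underline{i})=\dim_{\mathbf{k}}(R/I_{\mathbb{X}})_{\underline{i}}$, and $\nu(I_{\mathbb{X}})$ is the minimal number of generators of $I_{\mathbb{X}}$. A set $\mathbb{X}$ of $s$ (distinct) points is in generic position if $H_{\mathbb{X}}(\underline{i})=\min\{N(\underline{i}),s\}$ for all $\underline{i}\in\mathbb{N}^k$; it is non-degenerate if $s>\max\{n_1,\ldots,n_k\}$. Set $\mathcal{D}=\min\{\underline{i}\in\mathbb{N}^k\mid N(\underline{i})>s\}$ and $\mathcal{D}+e_l=\{\underline{i}+e_l\mid\underline{i}\in\mathcal{D}\}$. For $\underline{i}\in\mathcal{D}$ set $\mathbb{D}_{\underline{i}}=\{\underline{j}\in\mathbb{N}^k\mid\underline{j}\ge\underline{i}\}\setminus\{\underline{i},\underline{i}+e_1,\ldots,\underline{i}+e_k\}$, and set $\mathbb{D}=\left[\bigcup_{l=1}^k(\mathcal{D}+e_l)\right]\setminus\left[\bigcup_{\underline{i}\in\mathcal{D}}\mathbb{D}_{\underline{i}}\right]$. For $\underline{j}\in\mathbb{D}$ let $L_{\underline{j}}=\{l\in[k]\mid\underline{j}\in\mathcal{D}+e_l\}$. *)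

theory Defs
  imports
    "HOL-Library.Poly_Mapping"
    "HOL-Library.FuncSet"
    "HOL-Library.Function_Algebras"
    "HOL-Library.Extended_Nat"
    "HOL-Computational_Algebra.Polynomial"
    "HOL-Algebra.QuotRing"
    "HOL-Algebra.Embedded_Algebras"
begin

section \<open>Multidegrees\<close>

text \<open>
  An element of $N^k$ is a function \<open>nat \<Rightarrow> nat\<close> that is zero outside \<open>{1..k}\<close>. On such
  functions the library's \<open>\<le>\<close>, \<open>+\<close> and \<open>-\<close> are coordinatewise (subtraction truncates, but
  is only used below where it is exact).
\<close>

definition multidegrees :: "nat \<Rightarrow> (nat \<Rightarrow> nat) set" where
  "multidegrees k = {i. \<forall>l. l \<notin> {1..k} \<longrightarrow> i l = 0}"

definition unit_deg :: "nat \<Rightarrow> nat \<Rightarrow> nat" where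
  "unit_deg l = (\<lambda>m. if m = l then 1 else 0)"

definition min_elems :: "(nat \<Rightarrow> nat) set \<Rightarrow> (nat \<Rightarrow> nat) set" where
  "min_elems S = {i \<in> S. \<forall>j\<in>S. j \<le> i \<longrightarrow> j = i}"


section \<open>The multigraded polynomial ring\<close>

text \<open>
  A monomial is a finitely supported exponent function on the variables, where \<open>(l, m)\<close>
  stands for $x_{l,m}$; a polynomial is a finitely supported coefficient function on the
  monomials. The library's multiplication on these types is the convolution product.
\<close>

type_synonym monomial = "nat \<times> nat \<Rightarrow>\<^sub>0 nat"
type_synonym 'a mpolynomial = "monomial \<Rightarrow>\<^sub>0 'a"

definition ring_vars :: "nat \<Rightarrow> (nat \<Rightarrow> nat) \<Rightarrow> (nat \<times> nat) set" where
  "ring_vars k n = (SIGMA l:{1..k}. {0..n l})"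

definition coord_ring :: "nat \<Rightarrow> (nat \<Rightarrow> nat) \<Rightarrow> 'a::field mpolynomial ring" where
  "coord_ring k n =
     \<lparr>carrier = {f. \<forall>t\<in>Poly_Mapping.keys f. Poly_Mapping.keys t \<subseteq> ring_vars k n},
      monoid.mult = (*), one = 1, ring.zero = 0, add = (+)\<rparr>"

definition const_poly :: "'a::field \<Rightarrow> 'a mpolynomial" where
  "const_poly c = Poly_Mapping.single 0 c"

definition mon_deg :: "monomial \<Rightarrow> nat \<Rightarrow> nat" where
  "mon_deg t = (\<lambda>l. \<Sum>x\<in>{x \<in> Poly_Mapping.keys t. fst x = l}. Poly_Mapping.lookup t x)"

definition homog_part :: "nat \<Rightarrow> (nat \<Rightarrow> nat) \<Rightarrow> (nat \<Rightarrow> nat) \<Rightarrow> 'a::field mpolynomial set" where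
  "homog_part k n i = {f \<in> carrier (coord_ring k n). \<forall>t\<in>Poly_Mapping.keys f. mon_deg t = i}"

definition poly_eval :: "'a::field mpolynomial \<Rightarrow> (nat \<Rightarrow> nat \<Rightarrow> 'a) \<Rightarrow> 'a" where
  "poly_eval f a = (\<Sum>t\<in>Poly_Mapping.keys f. Poly_Mapping.lookup f t *
     (\<Prod>x\<in>Poly_Mapping.keys t. a (fst x) (snd x) ^ Poly_Mapping.lookup t x))"

text \<open>$N(i) = \prod_l \binom{n_l + i_l}{i_l}$\<close>

definition N_fun :: "nat \<Rightarrow> (nat \<Rightarrow> nat) \<Rightarrow> (nat \<Rightarrow> nat) \<Rightarrow> nat" where
  "N_fun k n i = (\<Prod>l\<in>{1..k}. (n l + i l) choose (i l))"


section \<open>Points, vanishing ideals and Hilbert functions\<close>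

definition nonzero_vecs :: "nat \<Rightarrow> (nat \<Rightarrow> 'a::field) set" where
  "nonzero_vecs d = {v \<in> {0..d} \<rightarrow>\<^sub>E UNIV. \<exists>m\<in>{0..d}. v m \<noteq> 0}"

definition proportional :: "nat \<Rightarrow> ((nat \<Rightarrow> 'a::field) \<times> (nat \<Rightarrow> 'a)) set" where
  "proportional d = {(u, v). u \<in> nonzero_vecs d \<and> v \<in> nonzero_vecs d \<and>
     (\<exists>c. c \<noteq> 0 \<and> (\<forall>m\<in>{0..d}. v m = c * u m))}"

definition proj_space :: "nat \<Rightarrow> (nat \<Rightarrow> 'a::field) set set" where
  "proj_space d = nonzero_vecs d // proportional d"

text \<open>
  A point of the product is a tuple of classes, so the choices of homogeneous coordinates
  for \<open>P\<close> are the \<open>a \<in> Pi {1..k} P\<close>.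
\<close>

definition multiproj_space :: "nat \<Rightarrow> (nat \<Rightarrow> nat) \<Rightarrow> (nat \<Rightarrow> (nat \<Rightarrow> 'a::field) set) set" where
  "multiproj_space k n = (\<Pi>\<^sub>E l\<in>{1..k}. proj_space (n l))"

definition vanishes_at :: "nat \<Rightarrow> 'a::field mpolynomial \<Rightarrow> (nat \<Rightarrow> (nat \<Rightarrow> 'a) set) \<Rightarrow> bool" where
  "vanishes_at k f P \<longleftrightarrow> (\<forall>a \<in> Pi {1..k} P. poly_eval f a = 0)"

definition vanishing_ideal ::
  "nat \<Rightarrow> (nat \<Rightarrow> nat) \<Rightarrow> (nat \<Rightarrow> (nat \<Rightarrow> 'a::field) set) set \<Rightarrow> 'a mpolynomial set" where
  "vanishing_ideal k n pts = Idl\<^bsub>coord_ring k n\<^esub>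
     {f. (\<exists>i\<in>multidegrees k. f \<in> homog_part k n i) \<and> (\<forall>P\<in>pts. vanishes_at k f P)}"

text \<open>
  The graded piece of the quotient ring is the image of the graded piece of the ring. Its
  dimension is taken inside the quotient ring, over the image of the constants.
\<close>

definition hilbert_fun ::
  "nat \<Rightarrow> (nat \<Rightarrow> nat) \<Rightarrow> (nat \<Rightarrow> (nat \<Rightarrow> 'a::field) set) set \<Rightarrow> (nat \<Rightarrow> nat) \<Rightarrow> nat" where
  "hilbert_fun k n pts i =
     (let R = coord_ring k n; I = vanishing_ideal k n pts
      in ring.dim (R Quot I) ((\<lambda>c. I +>\<^bsub>R\<^esub> const_poly c) ` UNIV)
           ((\<lambda>f. I +>\<^bsub>R\<^esub> f) ` homog_part k n i))"

definition generic_position ::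
  "nat \<Rightarrow> (nat \<Rightarrow> nat) \<Rightarrow> (nat \<Rightarrow> (nat \<Rightarrow> 'a::field) set) set \<Rightarrow> bool" where
  "generic_position k n pts \<longleftrightarrow>
     (\<forall>i\<in>multidegrees k. hilbert_fun k n pts i = min (N_fun k n i) (card pts))"

definition nondegenerate ::
  "nat \<Rightarrow> (nat \<Rightarrow> nat) \<Rightarrow> (nat \<Rightarrow> (nat \<Rightarrow> 'a::field) set) set \<Rightarrow> bool" where
  "nondegenerate k n pts \<longleftrightarrow> card pts > Max (n ` {1..k})"

text \<open>The value is \<open>\<infinity>\<close> exactly when \<open>I\<close> is not finitely generated.\<close>

definition min_num_gens :: "('b, 'c) ring_scheme \<Rightarrow> 'b set \<Rightarrow> enat" where
  "min_num_gens R I = (INF G\<in>{G. finite G \<and> G \<subseteq> carrier R \<and> Idl\<^bsub>R\<^esub> G = I}. enat (card G))"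


section \<open>The lower bound\<close>

definition D_set :: "nat \<Rightarrow> (nat \<Rightarrow> nat) \<Rightarrow> nat \<Rightarrow> (nat \<Rightarrow> nat) set" where
  "D_set k n s = min_elems {i \<in> multidegrees k. N_fun k n i > s}"

definition D_shift :: "nat \<Rightarrow> (nat \<Rightarrow> nat) \<Rightarrow> nat \<Rightarrow> nat \<Rightarrow> (nat \<Rightarrow> nat) set" where
  "D_shift k n s l = (\<lambda>i. i + unit_deg l) ` D_set k n s"

definition DD_excl :: "nat \<Rightarrow> (nat \<Rightarrow> nat) \<Rightarrow> (nat \<Rightarrow> nat) set" where
  "DD_excl k i = {j \<in> multidegrees k. j \<ge> i} - insert i ((\<lambda>l. i + unit_deg l) ` {1..k})"

definition DD_set :: "nat \<Rightarrow> (nat \<Rightarrow> nat) \<Rightarrow> nat \<Rightarrow> (nat \<Rightarrow> nat) set" where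
  "DD_set k n s = (\<Union>l\<in>{1..k}. D_shift k n s l) - (\<Union>i\<in>D_set k n s. DD_excl k i)"

definition L_set :: "nat \<Rightarrow> (nat \<Rightarrow> nat) \<Rightarrow> nat \<Rightarrow> (nat \<Rightarrow> nat) \<Rightarrow> nat set" where
  "L_set k n s j = {l \<in> {1..k}. j \<in> D_shift k n s l}"

definition v_bound :: "nat \<Rightarrow> (nat \<Rightarrow> nat) \<Rightarrow> nat \<Rightarrow> int" where
  "v_bound k n s =
     (\<Sum>i\<in>D_set k n s. int (N_fun k n i) - int s) +
     (\<Sum>j\<in>DD_set k n s. max 0 (int (N_fun k n j) - int s -
        (\<Sum>l\<in>L_set k n s j. int (n l + 1) * (int (N_fun k n (j - unit_deg l)) - int s))))"


section \<open>Sanity checks\<close>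

text \<open>So \<open>int (nat (v_bound k n s)) = v_bound k n s\<close>.\<close>

lemma v_bound_nonneg: "v_bound k n s \<ge> 0"
  unfolding v_bound_def
  by (intro add_nonneg_nonneg sum_nonneg) (auto simp: D_set_def min_elems_def)

lemma coord_ring_mult_closed:
  assumes "f \<in> carrier (coord_ring k n)" "g \<in> carrier (coord_ring k n)"
  shows "f * g \<in> carrier (coord_ring k n)"
proof -
  have "Poly_Mapping.keys t \<subseteq> ring_vars k n" if "t \<in> Poly_Mapping.keys (f * g)" for t
  proof -
    obtain u v where "u \<in> Poly_Mapping.keys f" "v \<in> Poly_Mapping.keys g" "t = u + v"
      using keys_mult[of f g] \<open>t \<in> Poly_Mapping.keys (f * g)\<close> by blast
    then show ?thesis
      using assms Poly_Mapping.keys_add[of u v] unfolding coord_ring_def by fastforce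
  qed
  then show ?thesis by (simp add: coord_ring_def)
qed

lemma cring_coord_ring: "cring (coord_ring k n :: 'a::field mpolynomial ring)"
proof (rule cringI)
  show "abelian_group (coord_ring k n :: 'a mpolynomial ring)"
  proof (rule abelian_groupI)
    fix x y :: "'a mpolynomial"
    assume "x \<in> carrier (coord_ring k n)" "y \<in> carrier (coord_ring k n)"
    then show "x \<oplus>\<^bsub>coord_ring k n\<^esub> y \<in> carrier (coord_ring k n)"
      using Poly_Mapping.keys_add[of x y] unfolding coord_ring_def by fastforce
  next
    fix x :: "'a mpolynomial"
    assume "x \<in> carrier (coord_ring k n)"
    then show "\<exists>y\<in>carrier (coord_ring k n). y \<oplus>\<^bsub>coord_ring k n\<^esub> x = \<zero>\<^bsub>coord_ring k n\<^esub>"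
      by (intro bexI[of _ "- x"]) (auto simp: coord_ring_def)
  qed (auto simp: coord_ring_def algebra_simps)
  show "Group.comm_monoid (coord_ring k n :: 'a mpolynomial ring)"
  proof (rule comm_monoidI)
    fix x y :: "'a mpolynomial"
    assume "x \<in> carrier (coord_ring k n)" "y \<in> carrier (coord_ring k n)"
    from coord_ring_mult_closed[OF this]
    show "x \<otimes>\<^bsub>coord_ring k n\<^esub> y \<in> carrier (coord_ring k n)"
      by (simp add: coord_ring_def)
  qed (auto simp: coord_ring_def algebra_simps)
qed (auto simp: coord_ring_def algebra_simps)

end

theory Submission
  imports Defs
begin

text \<open>
  The ideal $I$ of the points is graded, and genericity gives $\dim I_i = \max(0, N(i) - s)$.
  Let $F$ be a finite set of multidegrees and let $W_j \subseteq I_j$ be spanned by the products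
  in degree $j$ of a variable and a homogeneous element of $I$. If $G$ generates $I$, then the
  elements of $I$ whose projection to the degrees in $F$ lies in the span of the projections of
  $G$ and of the $W_j$ form an ideal containing $G$, hence they are all of $I$. Comparing
  dimensions, $\sum_{j \in F} (\dim I_j - \dim W_j) \le |G|$. Moreover $\dim W_j \le \sum_l (n_l
  + 1) \dim I_{j - e_l}$, and for $j \in \mathcal{D} \cup \mathbb{D}$ the only nonzero terms are
  those with $l \in L_j$. Take for $F$ the set $\mathcal{D}$ and those $j \in \mathbb{D}$ whose
  contribution to $v$ is positive.
\<close>

section \<open>Projections onto sets of multidegrees\<close>

text \<open>Projection onto the sum of the graded pieces with degrees in \<open>S\<close>. A set
  instead of a single degree serves both for one component and for all degrees of \<open>F\<close>
  at once, and it absorbs degree shifts as preimages, without subtracting degrees.\<close>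

definition deg_proj :: "(nat \<Rightarrow> nat) set \<Rightarrow> 'a::field mpolynomial \<Rightarrow> 'a mpolynomial" where
  "deg_proj S = Poly_Mapping.mapp (\<lambda>t c. c when mon_deg t \<in> S)"

lemma lookup_deg_proj:
  "Poly_Mapping.lookup (deg_proj S f) t = (Poly_Mapping.lookup f t when mon_deg t \<in> S)"
  by (auto simp: deg_proj_def lookup_mapp when_def in_keys_iff)

lemma keys_deg_proj: "Poly_Mapping.keys (deg_proj S f) = {t \<in> Poly_Mapping.keys f. mon_deg t \<in> S}"
  by (auto simp: in_keys_iff lookup_deg_proj)

lemma deg_proj_0 [simp]: "deg_proj S 0 = 0"
  by (rule poly_mapping_eqI) (simp add: lookup_deg_proj)

lemma deg_proj_add: "deg_proj S (f + g) = deg_proj S f + deg_proj S g"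
  by (rule poly_mapping_eqI) (simp add: lookup_deg_proj lookup_add when_def)

lemma deg_proj_sum: "deg_proj S (sum f A) = (\<Sum>x\<in>A. deg_proj S (f x))"
  by (induction A rule: infinite_finite_induct) (simp_all add: deg_proj_add)

lemma deg_proj_single:
  "deg_proj S (Poly_Mapping.single t c) = (Poly_Mapping.single t c when mon_deg t \<in> S)"
  by (rule poly_mapping_eqI) (simp add: lookup_deg_proj lookup_single when_def)

lemma deg_proj_disjoint_sum:
  assumes "finite F"
  shows "deg_proj F f = (\<Sum>j\<in>F. deg_proj {j} f)"
  by (rule poly_mapping_eqI) (use assms in \<open>auto simp: lookup_deg_proj lookup_sum when_def\<close>)

lemma deg_proj_homog_part:
  assumes "f \<in> homog_part k n i"
  shows "deg_proj S f = (f when i \<in> S)"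
  by (rule poly_mapping_eqI)
    (use assms in \<open>force simp: lookup_deg_proj when_def homog_part_def in_keys_iff\<close>)

section \<open>Multidegrees of products of monomials\<close>

lemma mon_deg_eq_sum:
  assumes "finite A" "Poly_Mapping.keys t \<subseteq> A"
  shows "mon_deg t l = (\<Sum>x\<in>{x \<in> A. fst x = l}. Poly_Mapping.lookup t x)"
  unfolding mon_deg_def
  by (rule sum.mono_neutral_left) (use assms in \<open>auto simp: in_keys_iff\<close>)

lemma mon_deg_add: "mon_deg (t + u) = mon_deg t + mon_deg u"
proof
  fix l
  \<comment> \<open>Both degrees are summed over one common finite index set, so that they add
    termwise.\<close>
  define A where "A = Poly_Mapping.keys t \<union> Poly_Mapping.keys u"
  have A: "finite A" "Poly_Mapping.keys t \<subseteq> A" "Poly_Mapping.keys u \<subseteq> A"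
    "Poly_Mapping.keys (t + u) \<subseteq> A"
    using Poly_Mapping.keys_add[of t u] by (auto simp: A_def)
  show "mon_deg (t + u) l = (mon_deg t + mon_deg u) l"
    by (simp add: A(1)[THEN mon_deg_eq_sum] A(2-) lookup_add sum.distrib)
qed

lemma mon_deg_0 [simp]: "mon_deg 0 = 0"
  by (simp add: mon_deg_def fun_eq_iff)

lemma mon_deg_single_one: "mon_deg (Poly_Mapping.single v 1) = unit_deg (fst v)"
proof
  fix l
  have "{x \<in> {v}. fst x = l} = (if fst v = l then {v} else {})" by auto
  then show "mon_deg (Poly_Mapping.single v 1) l = unit_deg (fst v) l"
    by (simp add: mon_deg_eq_sum[of "{v}"] unit_deg_def)
qed

lemma poly_mapping_sum_single:
  fixes f :: "'b \<Rightarrow>\<^sub>0 'c::comm_monoid_add"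
  shows "f = (\<Sum>t\<in>Poly_Mapping.keys f. Poly_Mapping.single t (Poly_Mapping.lookup f t))"
  by (rule poly_mapping_eqI)
    (auto simp: lookup_sum lookup_single when_def in_keys_iff)

text \<open>Multiplication by a monomial translates all degrees, so the projection passes through it
  with \<open>S\<close> replaced by its preimage under the translation; by additivity it suffices to
  compare single terms.\<close>

lemma deg_proj_mult_single:
  "deg_proj S (Poly_Mapping.single t c * f) =
     Poly_Mapping.single t c * deg_proj {i. mon_deg t + i \<in> S} f"
proof -
  have "deg_proj S (Poly_Mapping.single t c * (\<Sum>u\<in>U. Poly_Mapping.single u (a u))) =
      Poly_Mapping.single t c * deg_proj {i. mon_deg t + i \<in> S} (\<Sum>u\<in>U. Poly_Mapping.single u (a u))"
    for U a
    by (simp add: sum_distrib_left deg_proj_sum mult_single deg_proj_single mon_deg_add mult_when)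
  from this[where U = "Poly_Mapping.keys f" and a = "Poly_Mapping.lookup f"] show ?thesis
    by (simp flip: poly_mapping_sum_single)
qed

section \<open>Linear algebra and ideals in the coordinate ring\<close>

lemma const_poly_simps [simp]: "const_poly 0 = 0" "const_poly 1 = 1"
  by (simp_all add: const_poly_def)

lemma const_poly_add: "const_poly (c + d) = const_poly c + const_poly d"
  by (simp add: const_poly_def single_add)

lemma const_poly_mult: "const_poly (c * d) = const_poly c * const_poly d"
  by (simp add: const_poly_def mult_single)

text \<open>Spans and independence are taken over the field itself, among polynomials. The dimension
  in \<open>hilbert_fun\<close> lives in a quotient ring over the image of the constants;
  \<open>dim_quotient_homog_part\<close> links the two.\<close>

interpretation mp: vector_space "\<lambda>(c::'a::field) (f::'a mpolynomial). const_poly c * f"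
  by unfold_locales (simp_all add: const_poly_add const_poly_mult algebra_simps)

section \<open>Ideals of the coordinate ring\<close>

lemma carrier_coord_ring:
  "f \<in> carrier (coord_ring k n) \<longleftrightarrow> (\<forall>t\<in>Poly_Mapping.keys f. Poly_Mapping.keys t \<subseteq> ring_vars k n)"
  by (simp add: coord_ring_def)

lemma coord_ring_simps [simp]:
  "f \<otimes>\<^bsub>coord_ring k n\<^esub> g = f * g" "f \<oplus>\<^bsub>coord_ring k n\<^esub> g = f + g"
  "\<one>\<^bsub>coord_ring k n\<^esub> = 1" "\<zero>\<^bsub>coord_ring k n\<^esub> = 0"
  by (simp_all add: coord_ring_def)

lemma ring_coord_ring: "ring (coord_ring k n :: 'a::field mpolynomial ring)"
  using cring_coord_ring by (rule cring.axioms)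

lemma single_carrier:
  "Poly_Mapping.keys t \<subseteq> ring_vars k n \<Longrightarrow> Poly_Mapping.single t c \<in> carrier (coord_ring k n)"
  by (auto simp: carrier_coord_ring)

lemma const_poly_carrier: "const_poly c \<in> carrier (coord_ring k n)"
  by (simp add: const_poly_def single_carrier)

lemma uminus_coord_ring:
  assumes "f \<in> carrier (coord_ring k n)"
  shows "\<ominus>\<^bsub>coord_ring k n\<^esub> f = - f"
proof -
  interpret ring "coord_ring k n :: 'a mpolynomial ring" by (rule ring_coord_ring)
  have "- f = const_poly (-1) * f" by (simp add: mp.scale_minus_left)
  then have "- f \<in> carrier (coord_ring k n)"
    using coord_ring_mult_closed[OF const_poly_carrier assms] by metis
  then show ?thesis
    using minus_equality[of "- f" f] assms by simp
qed

text \<open>Every ring element is a finite sum of terms, so closure under sums and under products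
  with single terms is enough.\<close>

lemma ideal_coord_ringI:
  fixes J :: "'a::field mpolynomial set"
  assumes "J \<subseteq> carrier (coord_ring k n)" "0 \<in> J" "\<And>f g. f \<in> J \<Longrightarrow> g \<in> J \<Longrightarrow> f + g \<in> J"
    and single: "\<And>t c f. Poly_Mapping.keys t \<subseteq> ring_vars k n \<Longrightarrow> f \<in> J \<Longrightarrow>
      Poly_Mapping.single t c * f \<in> J"
  shows "ideal J (coord_ring k n)"
proof -
  interpret ring "coord_ring k n :: 'a mpolynomial ring" by (rule ring_coord_ring)
  have mult: "r * f \<in> J" "f * r \<in> J" if "r \<in> carrier (coord_ring k n)" "f \<in> J" for r f
  proof -
    have "(\<Sum>t\<in>T. Poly_Mapping.single t (Poly_Mapping.lookup r t)) * f \<in> J"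
      if "finite T" "T \<subseteq> Poly_Mapping.keys r" for T
      using that
    proof (induction T rule: finite_induct)
      case empty
      then show ?case using assms(2) by simp
    next
      case (insert t T)
      then have "Poly_Mapping.keys t \<subseteq> ring_vars k n"
        using \<open>r \<in> carrier (coord_ring k n)\<close> by (auto simp: carrier_coord_ring)
      with insert show ?case
        by (auto simp: distrib_right intro!: assms(3) single \<open>f \<in> J\<close>)
    qed
    from this[of "Poly_Mapping.keys r"] show "r * f \<in> J"
      by (simp flip: poly_mapping_sum_single)
    then show "f * r \<in> J"
      by (simp add: mult.commute)
  qed
  have "subgroup J (add_monoid (coord_ring k n))"
  proof (rule add.subgroupI)
    \<comment> \<open>The negative is the product with the term of exponent 0 and coefficient
      -1.\<close>
    fix f assume "f \<in> J"
    then show "\<ominus>\<^bsub>coord_ring k n\<^esub> f \<in> J"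
      using single[of 0 f "-1"] assms(1) uminus_coord_ring[of f k n]
      by (auto simp flip: const_poly_def)
  next
    show "J \<noteq> {}" using assms(2) by blast
  qed (use assms(1,3) in auto)
  then show ?thesis
    using mult by (intro idealI ring_axioms) auto
qed

lemma ideal_coord_ringD:
  assumes "ideal I (coord_ring k n :: 'a::field mpolynomial ring)"
  shows "I \<subseteq> carrier (coord_ring k n)" "0 \<in> I" "f \<in> I \<Longrightarrow> g \<in> I \<Longrightarrow> f + g \<in> I"
    "r \<in> carrier (coord_ring k n) \<Longrightarrow> f \<in> I \<Longrightarrow> r * f \<in> I"
    "Poly_Mapping.keys t \<subseteq> ring_vars k n \<Longrightarrow> f \<in> I \<Longrightarrow> Poly_Mapping.single t c * f \<in> I"
proof -
  interpret I: ideal I "coord_ring k n" by (rule assms)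
  show "I \<subseteq> carrier (coord_ring k n)" by (rule I.a_subset)
  show "0 \<in> I" using additive_subgroup.zero_closed[OF I.is_additive_subgroup] by simp
  show "f + g \<in> I" if "f \<in> I" "g \<in> I"
    using additive_subgroup.a_closed[OF I.is_additive_subgroup that] by simp
  show *: "r * f \<in> I" if "r \<in> carrier (coord_ring k n)" "f \<in> I" for r
    using I.I_l_closed[OF that(2,1)] by simp
  show "Poly_Mapping.single t c * f \<in> I" if "Poly_Mapping.keys t \<subseteq> ring_vars k n" "f \<in> I"
    by (rule *[OF single_carrier[OF that(1)] that(2)])
qed

text \<open>The elements of the ideal with property \<open>P\<close> form an ideal that contains
  \<open>G\<close>, hence are everything. The case \<open>single\<close> keeps the membership of
  \<open>f\<close> in the ideal, because products with nonconstant monomials are later handled by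
  that membership alone.\<close>

lemma Idl_coord_ring_induct [consumes 2, case_names gen zero add single]:
  fixes G :: "'a::field mpolynomial set"
  assumes "f \<in> Idl\<^bsub>coord_ring k n\<^esub> G" "G \<subseteq> carrier (coord_ring k n)"
    and "\<And>f. f \<in> G \<Longrightarrow> P f" "P 0" "\<And>f g. P f \<Longrightarrow> P g \<Longrightarrow> P (f + g)"
    and "\<And>t c f. f \<in> Idl\<^bsub>coord_ring k n\<^esub> G \<Longrightarrow> Poly_Mapping.keys t \<subseteq> ring_vars k n \<Longrightarrow> P f \<Longrightarrow>
      P (Poly_Mapping.single t c * f)"
  shows "P f"
proof -
  interpret ring "coord_ring k n :: 'a mpolynomial ring" by (rule ring_coord_ring)
  let ?I = "Idl\<^bsub>coord_ring k n\<^esub> G"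
  have "ideal {f \<in> ?I. P f} (coord_ring k n)"
    using ideal_coord_ringD[OF genideal_ideal[OF assms(2)]] assms(4-)
    by (intro ideal_coord_ringI) auto
  moreover have "G \<subseteq> {f \<in> ?I. P f}"
    using genideal_self[OF assms(2)] assms(3) by auto
  ultimately show ?thesis
    using genideal_minimal assms(1) by blast
qed

section \<open>Graded pieces of the ring\<close>

lemma homog_part_zero: "0 \<in> homog_part k n i"
  and homog_part_add: "f \<in> homog_part k n i \<Longrightarrow> g \<in> homog_part k n i \<Longrightarrow> f + g \<in> homog_part k n i"
  using Poly_Mapping.keys_add[of f g] by (fastforce simp: homog_part_def coord_ring_def)+

lemma homog_part_carrier: "f \<in> homog_part k n i \<Longrightarrow> f \<in> carrier (coord_ring k n)"
  by (simp add: homog_part_def)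

lemma homog_part_mult_single:
  assumes "f \<in> homog_part k n i" "Poly_Mapping.keys t \<subseteq> ring_vars k n"
  shows "Poly_Mapping.single t c * f \<in> homog_part k n (mon_deg t + i)"
proof -
  have "mon_deg u = mon_deg t + i" if "u \<in> Poly_Mapping.keys (Poly_Mapping.single t c * f)" for u
    using that keys_mult[of "Poly_Mapping.single t c" f] assms(1)
    by (fastforce simp: homog_part_def mon_deg_add split: if_splits)
  then show ?thesis
    using coord_ring_mult_closed[OF single_carrier[OF assms(2)] homog_part_carrier[OF assms(1)]]
    by (simp add: homog_part_def)
qed

lemma deg_proj_in_homog_part:
  "f \<in> carrier (coord_ring k n) \<Longrightarrow> deg_proj {j} f \<in> homog_part k n j"
  by (simp add: homog_part_def carrier_coord_ring keys_deg_proj)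

lemma subspace_homog_part: "mp.subspace (homog_part k n i :: 'a::field mpolynomial set)"
proof (rule mp.subspaceI)
  fix c and f :: "'a mpolynomial" assume "f \<in> homog_part k n i"
  then show "const_poly c * f \<in> homog_part k n i"
    using homog_part_mult_single[of f k n i 0 c] by (simp add: const_poly_def)
qed (auto intro: homog_part_zero homog_part_add)

lemma subspace_ideal:
  assumes "ideal I (coord_ring k n :: 'a::field mpolynomial ring)"
  shows "mp.subspace I"
  using ideal_coord_ringD(2,3)[OF assms] ideal_coord_ringD(4)[OF assms const_poly_carrier]
  by (intro mp.subspaceI) auto

lemma deg_proj_linear: "deg_proj S (const_poly c * f) = const_poly c * deg_proj S f"
  by (simp add: const_poly_def deg_proj_mult_single)

lemma deg_proj_span:
  assumes "f \<in> mp.span A"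
  shows "deg_proj S f \<in> mp.span (deg_proj S ` A)"
  using assms
proof (induction rule: mp.span_induct_alt)
  case (step c x y)
  then show ?case
    by (simp add: deg_proj_add deg_proj_linear mp.span_add mp.span_scale mp.span_base)
qed (simp add: mp.span_zero)

text \<open>The graded pieces form a direct sum: projecting a relation that expresses
  \<open>b\<close> through the other elements to the degree of \<open>b\<close> kills all elements
  of other degrees and leaves a relation inside one \<open>B j\<close>.\<close>

lemma independent_UN_homog_part:
  assumes "\<And>j. j \<in> F \<Longrightarrow> mp.independent (B j)" "\<And>j. j \<in> F \<Longrightarrow> B j \<subseteq> homog_part k n j"
  shows "mp.independent (\<Union>j\<in>F. B j)"
proof
  assume "mp.dependent (\<Union>j\<in>F. B j)"
  then obtain j b where jb: "j \<in> F" "b \<in> B j" and span: "b \<in> mp.span ((\<Union>j\<in>F. B j) - {b})"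
    by (auto simp: mp.dependent_def)
  have sub: "deg_proj {j} ` ((\<Union>j\<in>F. B j) - {b}) \<subseteq> mp.span (B j - {b})"
  proof
    fix x assume "x \<in> deg_proj {j} ` ((\<Union>j\<in>F. B j) - {b})"
    then obtain i y where y: "i \<in> F" "y \<in> B i" "y \<noteq> b" "x = deg_proj {j} y" by auto
    then have "x = (y when i = j)"
      using assms(2)[OF y(1)] deg_proj_homog_part[of y k n i "{j}"] by auto
    then show "x \<in> mp.span (B j - {b})"
      using y by (auto simp: when_def mp.span_zero intro: mp.span_base)
  qed
  have "deg_proj {j} b = b"
    using assms(2)[OF jb(1)] jb(2) deg_proj_homog_part[of b k n j "{j}"] by auto
  then have "b \<in> mp.span (deg_proj {j} ` ((\<Union>j\<in>F. B j) - {b}))"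
    using deg_proj_span[OF span, of "{j}"] by (simp only:)
  then have "b \<in> mp.span (B j - {b})"
    using mp.span_minimal[OF sub mp.subspace_span] by (rule rev_subsetD)
  then show False
    using assms(1)[OF jb(1)] jb(2) by (auto simp: mp.dependent_def)
qed

section \<open>Generators and graded dimensions\<close>

text \<open>A Nakayama-type count. \<open>B j\<close> is a basis of I_j, and the inner sum on the
  right bounds the dimension of W_j. The elements of \<open>G\<close> may be inhomogeneous, which is
  why all degrees of \<open>F\<close> are treated at once through \<open>deg_proj F\<close>.\<close>

lemma sum_card_basis_le:
  fixes I :: "'a::field mpolynomial set" and B :: "(nat \<Rightarrow> nat) \<Rightarrow> 'a mpolynomial set"
  assumes I: "ideal I (coord_ring k n)" and hom: "\<And>S f. f \<in> I \<Longrightarrow> deg_proj S f \<in> I"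
    and G: "finite G" "G \<subseteq> carrier (coord_ring k n)" "Idl\<^bsub>coord_ring k n\<^esub> G = I"
    and F: "finite F" "F \<subseteq> multidegrees k"
    and B: "\<And>j. j \<in> multidegrees k \<Longrightarrow> finite (B j)"
      "\<And>j. j \<in> multidegrees k \<Longrightarrow> mp.independent (B j)"
      "\<And>j. j \<in> multidegrees k \<Longrightarrow> B j \<subseteq> I \<inter> homog_part k n j"
      "\<And>j. j \<in> multidegrees k \<Longrightarrow> I \<inter> homog_part k n j \<subseteq> mp.span (B j)"
  shows "(\<Sum>j\<in>F. card (B j)) \<le> card G +
    (\<Sum>j\<in>F. \<Sum>l\<in>{l\<in>{1..k}. 0 < j l}. (n l + 1) * card (B (j - unit_deg l)))"
proof -
  define X :: "nat \<times> nat \<Rightarrow> 'a mpolynomial"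
    where "X v = Poly_Mapping.single (Poly_Mapping.single v 1) 1" for v
  \<comment> \<open>A spanning set of W_j. The condition \<open>0 < j l\<close> matters: for
    \<open>j l = 0\<close> truncated subtraction would return \<open>j\<close> itself.\<close>
  define C where "C j = (\<Union>l\<in>{l\<in>{1..k}. 0 < j l}. \<Union>m\<in>{0..n l}.
    (\<lambda>b. X (l, m) * b) ` B (j - unit_deg l))" for j
  have lower: "j - unit_deg l \<in> multidegrees k" if "j \<in> multidegrees k" for j l
    using that by (simp add: multidegrees_def)
  have finite_C: "finite (C j)" if "j \<in> multidegrees k" for j
    using B(1)[OF lower[OF that]] by (simp add: C_def)
  have card_C: "card (C j) \<le> (\<Sum>l\<in>{l\<in>{1..k}. 0 < j l}. (n l + 1) * card (B (j - unit_deg l)))"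
    if "j \<in> multidegrees k" for j
  proof -
    have *: "card (\<Union>m\<in>{0..n l}. (\<lambda>b. X (l, m) * b) ` B (j - unit_deg l))
        \<le> (\<Sum>m\<in>{0..n l}. card (B (j - unit_deg l)))" for l
      by (intro order.trans[OF card_UN_le] sum_mono card_image_le B(1) lower that) simp
    show ?thesis
      unfolding C_def by (rule order.trans[OF card_UN_le sum_mono]) (use * in simp_all)
  qed
  \<comment> \<open>Multiplication by a variable is linear, so it is enough that it maps
    \<open>B (j - unit_deg l)\<close> into \<open>C j\<close>.\<close>
  have X_mult: "X (l, m) * h \<in> mp.span (C j)"
    if "l \<in> {1..k}" "0 < j l" "m \<in> {0..n l}" "j \<in> multidegrees k"
      "h \<in> I \<inter> homog_part k n (j - unit_deg l)" for l m j h
  proof -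
    have "h \<in> mp.span (B (j - unit_deg l))"
      using B(4)[OF lower[OF that(4)]] that(5) by blast
    then show ?thesis
    proof (induction rule: mp.span_induct_alt)
      case (step c x y)
      have "X (l, m) * x \<in> C j"
        using that(1-3) step(1) unfolding C_def by blast
      then have "const_poly c * (X (l, m) * x) + X (l, m) * y \<in> mp.span (C j)"
        by (intro mp.span_add mp.span_scale step mp.span_base)
      then show ?case by (simp add: algebra_simps)
    qed (simp add: mp.span_zero)
  qed
  \<comment> \<open>A nonconstant monomial is divisible by a variable, so it carries every component of an
    element of \<open>I\<close> into the span of the products of a variable and an element of \<open>I\<close>.\<close>
  have nonconst: "deg_proj {j} (Poly_Mapping.single t c * f) \<in> mp.span (C j)"
    if t: "Poly_Mapping.keys t \<subseteq> ring_vars k n" "t \<noteq> 0" and f: "f \<in> I" and j: "j \<in> multidegrees k"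
    for t c f j
  proof -
    obtain l m where v: "(l, m) \<in> Poly_Mapping.keys t"
      using t(2) by (metis keys_eq_empty ex_in_conv surj_pair)
    \<comment> \<open>One factor \<open>X (l, m)\<close> is split off; the subtraction is exact
      because the exponent of \<open>(l, m)\<close> in \<open>t\<close> is positive.\<close>
    define u where "u = t - Poly_Mapping.single (l, m) 1"
    have tu: "t = Poly_Mapping.single (l, m) 1 + u"
      using v by (intro poly_mapping_eqI)
        (auto simp: u_def lookup_add lookup_minus lookup_single when_def in_keys_iff)
    have u: "Poly_Mapping.keys u \<subseteq> ring_vars k n"
      using t(1) by (auto simp: u_def lookup_minus in_keys_iff)
    have lm: "l \<in> {1..k}" "m \<in> {0..n l}"
      using v t(1) by (auto simp: ring_vars_def)
    define h where "h = Poly_Mapping.single u c * f"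
    have h: "h \<in> I" using ideal_coord_ringD(5)[OF I u f] by (simp add: h_def)
    have "Poly_Mapping.single t c * f = X (l, m) * h"
      by (simp add: tu h_def X_def mult_single mult.assoc[symmetric])
    then have eq: "deg_proj {j} (Poly_Mapping.single t c * f) =
        X (l, m) * deg_proj {i. unit_deg l + i = j} h"
      by (simp add: X_def deg_proj_mult_single mon_deg_single_one[simplified])
    show ?thesis
    proof (cases "0 < j l")
      case True
      then have "unit_deg l + (j - unit_deg l) = j"
        by (auto simp: fun_eq_iff unit_deg_def)
      then have "{i. unit_deg l + i = j} = {j - unit_deg l}"
        by (auto intro: add_left_imp_eq)
      moreover have "deg_proj {j - unit_deg l} h \<in> I \<inter> homog_part k n (j - unit_deg l)"
        using hom[OF h] deg_proj_in_homog_part ideal_coord_ringD(1)[OF I] h by blast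
      ultimately show ?thesis
        using X_mult[OF lm(1) True lm(2) j] eq by simp
    next
      \<comment> \<open>A multiple of \<open>X (l, m)\<close> has no component in a degree with
        entry 0 at \<open>l\<close>.\<close>
      case False
      then have "{i. unit_deg l + i = j} = {}"
        by (auto simp: fun_eq_iff unit_deg_def) 
      moreover have "deg_proj {} h = 0"
        by (rule poly_mapping_eqI) (simp add: lookup_deg_proj)
      ultimately show ?thesis
        using eq by (simp add: mp.span_zero)
    qed
  qed
  define T where "T = deg_proj F ` G \<union> (\<Union>j\<in>F. C j)"
  have T: "deg_proj F f \<in> mp.span T" if "f \<in> I" for f
  proof -
    have "f \<in> Idl\<^bsub>coord_ring k n\<^esub> G" using that G(3) by simp
    then show ?thesis
      using G(2)
    proof (induction rule: Idl_coord_ring_induct)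
      case (gen f)
      then show ?case by (auto simp: T_def intro: mp.span_base)
    next
      case (add f g)
      then show ?case by (simp add: deg_proj_add mp.span_add)
    next
      case (single t c f)
      show ?case
      \<comment> \<open>A constant multiple is covered by the induction hypothesis; for a
        nonconstant monomial the membership of \<open>f\<close> in the ideal suffices, degree by
        degree.\<close>
      proof (cases "t = 0")
        case True
        then show ?thesis
          using single mp.span_scale[of "deg_proj F f" T c] deg_proj_linear[of F c f]
          by (simp add: const_poly_def)
      next
        case False
        have "deg_proj {j} (Poly_Mapping.single t c * f) \<in> mp.span T" if "j \<in> F" for j
          using nonconst[OF single(2) False, of f j c] single(1) that F(2) G(3)
            mp.span_mono[of "C j" T] by (auto simp: T_def)
        then show ?thesis
          by (simp add: deg_proj_disjoint_sum[OF F(1)] mp.span_sum)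
      qed
    qed (simp add: mp.span_zero)
  qed
  \<comment> \<open>A form of degree \<open>j\<close> \<in> \<open>F\<close> is its own projection.
    Hence the independent union of the \<open>B j\<close> lies in the span of the finite set
    \<open>T\<close> and has at most \<open>card T\<close> elements.\<close>
  have "B j \<subseteq> mp.span T" if "j \<in> F" for j
  proof
    fix b assume "b \<in> B j"
    then have "b \<in> I" "b \<in> homog_part k n j" using B(3) F(2) that by blast+
    then show "b \<in> mp.span T"
      using T[of b] deg_proj_homog_part[of b k n j F] that by simp
  qed
  moreover have "finite T"
    using F G(1) finite_C by (auto simp: T_def)
  moreover have "mp.independent (\<Union>j\<in>F. B j)"
    using B(2,3) F(2) by (intro independent_UN_homog_part[of F B k n]) blast+
  ultimately have "card (\<Union>j\<in>F. B j) \<le> card T"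
    using mp.independent_span_bound[of T "\<Union>j\<in>F. B j"] by blast
  moreover have "card (\<Union>j\<in>F. B j) = (\<Sum>j\<in>F. card (B j))"
  proof (rule card_UN_disjoint[OF F(1)])
    show "\<forall>i\<in>F. finite (B i)" using B(1) F(2) by blast
    show "\<forall>i\<in>F. \<forall>j\<in>F. i \<noteq> j \<longrightarrow> B i \<inter> B j = {}"
    proof (intro ballI impI, rule ccontr)
      fix i j assume ij: "i \<in> F" "j \<in> F" "i \<noteq> j" "B i \<inter> B j \<noteq> {}"
      then obtain b where b: "b \<in> B i" "b \<in> B j" by blast
      with ij B(3) F(2) have "b \<in> homog_part k n i" "b \<in> homog_part k n j" by blast+
      \<comment> \<open>Projection to degree \<open>i\<close> returns \<open>b\<close> by the first
        membership and 0 by the second.\<close>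
      then have "b = 0"
        using ij(3) deg_proj_homog_part[of b k n i "{i}"] deg_proj_homog_part[of b k n j "{i}"]
        by simp
      then show False
        using b(1) B(2)[of i] ij(1) F(2) mp.dependent_zero by blast
    qed
  qed
  moreover have "card T \<le> card G + (\<Sum>j\<in>F. card (C j))"
    unfolding T_def using G(1) F(1)
    by (intro order.trans[OF card_Un_le] add_mono card_image_le card_UN_le)
  moreover have "(\<Sum>j\<in>F. card (C j)) \<le>
      (\<Sum>j\<in>F. \<Sum>l\<in>{l\<in>{1..k}. 0 < j l}. (n l + 1) * card (B (j - unit_deg l)))"
    using card_C F(2) by (intro sum_mono) blast
  ultimately show ?thesis by linarith
qed

section \<open>Monomials of a given multidegree\<close>

text \<open>Stars and bars, transferred from lists to extensional functions so that the count can be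
  used for the factors of a \<open>PiE\<close>.\<close>

lemma card_extensional_sum_eq:
  "card {g \<in> {0..<m} \<rightarrow>\<^sub>E (UNIV :: nat set). sum g {0..<m} = d} = (d + m - 1) choose d"
proof -
  have "bij_betw (\<lambda>g. map g [0..<m]) {g \<in> {0..<m} \<rightarrow>\<^sub>E (UNIV :: nat set). sum g {0..<m} = d}
      {xs. length xs = m \<and> sum_list xs = d}"
  proof (rule bij_betwI[where g = "\<lambda>xs. \<lambda>i\<in>{0..<m}. xs ! i"], goal_cases)
    case 1
    then show ?case by (auto simp: interv_sum_list_conv_sum_set_nat)
  next
    case 2
    then show ?case by (auto simp: sum_list_sum_nth)
  next
    case (3 g)
    then have "g i = undefined" if "i \<notin> {0..<m}" for i
      using PiE_arb[of g "{0..<m}" _ i] that by blast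
    then show ?case by (intro ext) (simp add: restrict_def)
  next
    case (4 xs)
    then show ?case by (intro nth_equalityI) simp_all
  qed
  then show ?thesis
    using card_length_sum_list[of m d] by (simp add: bij_betw_same_card)
qed

lemma finite_ring_vars: "finite (ring_vars k n)"
  by (simp add: ring_vars_def)

lemma mon_deg_ring_vars:
  assumes "Poly_Mapping.keys t \<subseteq> ring_vars k n" "l \<in> {1..k}"
  shows "mon_deg t l = (\<Sum>m\<in>{0..n l}. Poly_Mapping.lookup t (l, m))"
proof -
  have "{x \<in> ring_vars k n. fst x = l} = Pair l ` {0..n l}"
    using assms(2) by (auto simp: ring_vars_def)
  then show ?thesis
    by (simp add: mon_deg_eq_sum[OF finite_ring_vars assms(1)] sum.reindex inj_on_def)
qed

text \<open>A monomial of degree \<open>i\<close> is an independent choice, for each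
  \<open>l\<close>, of exponents with sum \<open>i l\<close> for the \<open>n l + 1\<close>
  variables of the group \<open>l\<close>; each choice is counted by stars and bars.\<close>

lemma card_monomials_of_degree:
  assumes i: "i \<in> multidegrees k"
  shows "card {t. Poly_Mapping.keys t \<subseteq> ring_vars k n \<and> mon_deg t = i} = N_fun k n i"
    (is "card ?M = _")
proof -
  let ?E = "\<Pi>\<^sub>E l\<in>{1..k}. {g \<in> {0..<Suc (n l)} \<rightarrow>\<^sub>E UNIV. sum g {0..<Suc (n l)} = i l}"
  let ?f = "\<lambda>t. \<lambda>l\<in>{1..k}. \<lambda>m\<in>{0..<Suc (n l)}. Poly_Mapping.lookup t (l, m)"
  \<comment> \<open>The inverse map. The value 0 outside the variables of the ring replaces
    \<open>undefined\<close> and makes the support finite.\<close>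
  let ?h = "\<lambda>G x. if x \<in> ring_vars k n then G (fst x) (snd x) else 0 :: nat"
  have h: "finite {x. ?h G x \<noteq> 0}" for G
    by (rule finite_subset[OF _ finite_ring_vars]) auto
  have keys_h: "Poly_Mapping.keys (Abs_poly_mapping (?h G)) \<subseteq> ring_vars k n" for G
    by (auto simp: in_keys_iff lookup_Abs_poly_mapping[OF h] split: if_splits)
  have ivl: "{0..<Suc a} = {0..a}" for a
    by auto
  have "bij_betw ?f ?M ?E"
  proof (rule bij_betwI[where g = "\<lambda>G. Abs_poly_mapping (?h G)"], goal_cases)
    case 1
    show ?case
    proof
      fix t assume t: "t \<in> ?M"
      then have "(\<Sum>m\<in>{0..<Suc (n l)}. Poly_Mapping.lookup t (l, m)) = i l" if "l \<in> {1..k}" for l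
        unfolding ivl using mon_deg_ring_vars[OF _ that, of t n] by auto
      then show "?f t \<in> ?E" by auto
    qed
  next
    case 2
    show ?case
    proof
      fix G assume G: "G \<in> ?E"
      have "mon_deg (Abs_poly_mapping (?h G)) l = i l" for l
      proof (cases "l \<in> {1..k}")
        case True
        then have "(l, m) \<in> ring_vars k n" if "m \<in> {0..n l}" for m
          using that by (auto simp: ring_vars_def)
        then have "mon_deg (Abs_poly_mapping (?h G)) l = sum (G l) {0..n l}"
          unfolding mon_deg_ring_vars[OF keys_h True]
          by (intro sum.cong) (simp_all only: lookup_Abs_poly_mapping[OF h] fst_conv snd_conv if_True)
        also have "\<dots> = i l" using PiE_mem[OF G True] by (simp add: ivl)
        finally show ?thesis .
      next
        case False
        then have "{x \<in> ring_vars k n. fst x = l} = {}" by (auto simp: ring_vars_def)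
        then show ?thesis
          using i False
          by (auto simp only: mon_deg_eq_sum[OF finite_ring_vars keys_h] multidegrees_def sum.empty)
      qed
      then show "Abs_poly_mapping (?h G) \<in> ?M"
        using keys_h by auto
    qed
  next
    case (3 t)
    then have "Poly_Mapping.lookup t x = 0" if "x \<notin> ring_vars k n" for x
      using that by (auto simp: in_keys_iff)
    then show ?case
      by (intro poly_mapping_eqI) (auto simp: lookup_Abs_poly_mapping[OF h] ring_vars_def)
  next
    case (4 G)
    show ?case
    proof
      fix l
      show "?f (Abs_poly_mapping (?h G)) l = G l"
      proof (cases "l \<in> {1..k}")
        case True
        then have "G l \<in> {0..<Suc (n l)} \<rightarrow>\<^sub>E UNIV" using PiE_mem[OF 4 True] by simp
        then have "G l m = undefined" if "m \<notin> {0..<Suc (n l)}" for m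
          using PiE_arb[of "G l" "{0..<Suc (n l)}" _ m] that by blast
        then show ?thesis
          using True by (auto simp: fun_eq_iff lookup_Abs_poly_mapping[OF h] ring_vars_def)
      next
        case False
        then show ?thesis using PiE_arb[OF 4] by (simp del: atLeastAtMost_iff)
      qed
    qed
  qed
  then have "card ?M = card ?E" by (rule bij_betw_same_card)
  also have "\<dots> = (\<Prod>l\<in>{1..k}. (i l + Suc (n l) - 1) choose (i l))"
    by (simp only: card_PiE finite_atLeastAtMost card_extensional_sum_eq)
  finally show ?thesis
    by (simp add: N_fun_def add.commute)
qed

section \<open>Dimensions in the quotient ring\<close>

lemma carrier_FactRing: "carrier (R Quot I) = (\<lambda>f. I +>\<^bsub>R\<^esub> f) ` carrier R"
  unfolding FactRing_def A_RCOSETS_def' by auto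

text \<open>Supplies the subfield over which dimensions in the quotient are taken; the inverse of a
  nonzero constant is again a constant.\<close>

lemma subfield_const_poly:
  "subfield (range const_poly :: 'a::field mpolynomial set) (coord_ring k n)"
proof -
  interpret cring "coord_ring k n :: 'a mpolynomial ring" by (rule cring_coord_ring)
  let ?K = "range const_poly :: 'a mpolynomial set"
  have "subring ?K (coord_ring k n)"
  proof (rule subringI)
    show "?K \<subseteq> carrier (coord_ring k n)" using const_poly_carrier by auto
    show "\<one>\<^bsub>coord_ring k n\<^esub> \<in> ?K" by (metis const_poly_simps(2) coord_ring_simps(3) rangeI)
    fix x y :: "'a mpolynomial" assume x: "x \<in> ?K"
    show "\<ominus>\<^bsub>coord_ring k n\<^esub> x \<in> ?K"
    proof -
      obtain c where "x = const_poly c" using x by blast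
      moreover have "- const_poly c = const_poly (- c)" by (simp add: const_poly_def single_uminus)
      ultimately show ?thesis using uminus_coord_ring[OF const_poly_carrier] by (metis rangeI)
    qed
    assume "y \<in> ?K"
    with x show "x \<otimes>\<^bsub>coord_ring k n\<^esub> y \<in> ?K" "x \<oplus>\<^bsub>coord_ring k n\<^esub> y \<in> ?K"
      by (auto simp flip: const_poly_mult const_poly_add)
  qed
  moreover have "Units (coord_ring k n\<lparr>carrier := ?K\<rparr>) = ?K - {\<zero>\<^bsub>coord_ring k n\<^esub>}"
  proof -
    have "\<exists>d. const_poly d * const_poly c = 1 \<and> const_poly c * const_poly d = 1" if "c \<noteq> 0" for c :: 'a
      using that by (intro exI[of _ "inverse c"]) (simp flip: const_poly_mult)
    moreover have "const_poly c \<noteq> 0" if "c \<noteq> 0" for c :: 'a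
      using that unfolding const_poly_def by (metis lookup_single_eq lookup_zero)
    ultimately show ?thesis
      by (auto simp: Units_def) (metis const_poly_simps(1))
  qed
  ultimately show ?thesis
    by (intro subfieldI subcringI') auto
qed

text \<open>The quotient is the zero ring. There the image of the constants is not a subfield, so
  the dimension is computed directly from its inductive definition.\<close>

lemma dim_quotient_one_in_ideal:
  fixes I :: "'a::field mpolynomial set"
  assumes I: "ideal I (coord_ring k n)" and one: "1 \<in> I"
    and E: "E \<subseteq> carrier (coord_ring k n Quot I)" "E \<noteq> {}"
  shows "ring.dim (coord_ring k n Quot I) K E = 0"
proof -
  interpret R: ring "coord_ring k n :: 'a mpolynomial ring" by (rule ring_coord_ring)
  interpret I: ideal I "coord_ring k n" by (rule I)
  define Q where "Q = coord_ring k n Quot I"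
  interpret Q: ring Q unfolding Q_def by (rule I.quotient_is_ring)
  have "I = carrier (coord_ring k n)"
    using I.one_imp_carrier one unfolding coord_ring_simps(3) by blast
  then have "x = I" if "x \<in> carrier Q" for x
    using that R.a_rcos_zero[OF I] unfolding Q_def carrier_FactRing by blast
  moreover have "\<zero>\<^bsub>Q\<^esub> = I"
    by (simp add: Q_def FactRing_def)
  ultimately have carrier: "carrier Q = {\<zero>\<^bsub>Q\<^esub>}"
    using Q.zero_closed by blast
  \<comment> \<open>Raising the dimension would require a vector outside a set that already contains
    0, and the carrier has no other element.\<close>
  have zero: "m = 0 \<and> X = {\<zero>\<^bsub>Q\<^esub>}" if "Q.dimension m K X" for m X
    using that by (induction rule: Q.dimension.induct) (use carrier in auto)
  have "E \<subseteq> {\<zero>\<^bsub>Q\<^esub>}"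
    using E(1) by (simp only: carrier flip: Q_def)
  then have "E = {\<zero>\<^bsub>Q\<^esub>}"
    using E(2) by (metis subset_singletonD)
  then have "Q.dimension 0 K E"
    by (simp only: Q.dimension.zero_dim)
  then show ?thesis
    unfolding Q_def[symmetric] Q.dim_def by (rule the_equality) (rule zero[THEN conjunct1])
qed

text \<open>\<open>B\<close> accounts for I_i and \<open>C\<close> completes it to the whole graded
  piece, so the cosets of \<open>C\<close> form a basis of the image of that piece in the
  quotient.\<close>

lemma dim_quotient_homog_part:
  fixes I :: "'a::field mpolynomial set"
  assumes I: "ideal I (coord_ring k n)" "1 \<notin> I"
    and B: "I \<inter> homog_part k n i \<subseteq> mp.span B" "B \<subseteq> I"
    and C: "finite C" "C \<inter> B = {}" "mp.independent (B \<union> C)" "C \<subseteq> homog_part k n i"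
      "homog_part k n i \<subseteq> mp.span (B \<union> C)"
  defines "\<pi> \<equiv> (+>\<^bsub>coord_ring k n\<^esub>) I"
  shows "ring.dim (coord_ring k n Quot I) (range (\<lambda>c. \<pi> (const_poly c))) (\<pi> ` homog_part k n i) = card C"
proof -
  interpret R: cring "coord_ring k n :: 'a mpolynomial ring" by (rule cring_coord_ring)
  interpret I: ideal I "coord_ring k n" by (rule I)
  define Q where "Q = coord_ring k n Quot I"
  interpret h: ring_hom_ring "coord_ring k n" Q \<pi>
    unfolding \<pi>_def Q_def by (rule I.rcos_ring_hom_ring)
  define K where "K = range (\<lambda>c. \<pi> (const_poly c))"
  have add: "\<pi> f \<oplus>\<^bsub>Q\<^esub> \<pi> g = \<pi> (f + g)" and mult: "\<pi> f \<otimes>\<^bsub>Q\<^esub> \<pi> g = \<pi> (f * g)"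
    if "f \<in> carrier (coord_ring k n)" "g \<in> carrier (coord_ring k n)" for f g
    using h.hom_add[OF that] h.hom_mult[OF that] by simp_all
  have zero: "\<zero>\<^bsub>Q\<^esub> = \<pi> 0"
    using h.hom_zero by simp
  have eq_iff: "\<pi> f = \<pi> g \<longleftrightarrow> f - g \<in> I"
    if "f \<in> carrier (coord_ring k n)" "g \<in> carrier (coord_ring k n)" for f g
    using R.quotient_eq_iff_same_a_r_cos[OF I(1) that] that uminus_coord_ring[of g k n]
    by (simp add: \<pi>_def a_minus_def)
  \<comment> \<open>As 1 is not in \<open>I\<close>, the quotient is nonzero and the image of the
    constants is still a field.\<close>
  have K: "subfield K Q"
  proof -
    have "\<one>\<^bsub>Q\<^esub> \<noteq> \<zero>\<^bsub>Q\<^esub>"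
      using eq_iff[of 1 0] I(2) zero h.hom_one R.one_closed R.zero_closed by simp
    from h.img_is_subfield(2)[OF subfield_const_poly this] show ?thesis
      by (simp add: K_def image_image)
  qed
  have C_carrier: "C \<subseteq> carrier (coord_ring k n)"
    using C(4) homog_part_carrier by blast
  have span: "mp.span A \<subseteq> homog_part k n i" if "A \<subseteq> C" for A
    using that C(4) by (intro mp.span_minimal subspace_homog_part) auto
  \<comment> \<open>Independence and span in the quotient are defined for lists, hence the induction
    on \<open>us\<close>. The description of the span is carried along because it decides whether
    the next coset is new.\<close>
  have *: "h.S.independent K (map \<pi> us) \<and> h.S.Span K (map \<pi> us) = \<pi> ` mp.span (set us)"
    if "distinct us" "set us \<subseteq> C" for us
    using that
  proof (induction us)
    case Nil
    then show ?case by (simp add: zero)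
  next
    case (Cons u us)
    then have IH: "h.S.independent K (map \<pi> us)" "h.S.Span K (map \<pi> us) = \<pi> ` mp.span (set us)"
      and u: "u \<in> C" "u \<notin> set us" "u \<in> homog_part k n i" "u \<in> carrier (coord_ring k n)"
      and us: "set us \<subseteq> C"
      using C(4) C_carrier by auto
    \<comment> \<open>Otherwise \<open>u - w\<close> would lie in I_i, hence in the span of
      \<open>B\<close>, and \<open>u\<close> would depend on the other elements of
      \<open>B \<union> C\<close>.\<close>
    have "\<pi> u \<notin> h.S.Span K (map \<pi> us)"
    proof
      assume "\<pi> u \<in> h.S.Span K (map \<pi> us)"
      then obtain w where w: "w \<in> mp.span (set us)" "\<pi> u = \<pi> w" using IH(2) by auto
      have "w \<in> homog_part k n i" using span[OF us] w(1) by blast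
      then have "u - w \<in> I \<inter> homog_part k n i"
        using eq_iff[OF u(4) homog_part_carrier[of w k n i]] w(2) u(3)
          mp.subspace_diff[OF subspace_homog_part] by auto
      then have "u - w \<in> mp.span (B \<union> set us)"
        using B(1) mp.span_mono[of B "B \<union> set us"] by blast
      moreover have "w \<in> mp.span (B \<union> set us)"
        using w(1) mp.span_mono[of "set us" "B \<union> set us"] by blast
      ultimately have "u \<in> mp.span (B \<union> set us)"
        using mp.span_add[of "u - w" "B \<union> set us" w] by simp
      moreover have "B \<union> set us \<subseteq> (B \<union> C) - {u}"
        using u(1,2) us C(2) by auto
      ultimately show False
        using C(3) u(1) mp.span_mono[of "B \<union> set us" "(B \<union> C) - {u}"]
        by (auto simp: mp.dependent_def)
    qed
    then have "h.S.independent K (map \<pi> (u # us))"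
      using IH(1) h.hom_closed[OF u(4)] by (auto intro: h.S.independent.intros)
    moreover have "h.S.Span K (map \<pi> (u # us)) = \<pi> ` mp.span (set (u # us))"
    proof -
      have carr: "w \<in> carrier (coord_ring k n)" if "w \<in> mp.span (set us)" for w
        using that span[OF us] homog_part_carrier by blast
      have "h.S.Span K (map \<pi> (u # us)) = h.S.line_extension K (\<pi> u) (\<pi> ` mp.span (set us))"
        using IH(2) by simp
      also have "\<dots> = {\<pi> (const_poly c * u + w) | c w. w \<in> mp.span (set us)}"
      proof -
        have "\<pi> (const_poly c) \<otimes>\<^bsub>Q\<^esub> \<pi> u \<oplus>\<^bsub>Q\<^esub> \<pi> w = \<pi> (const_poly c * u + w)"
          if "w \<in> mp.span (set us)" for c w
          using mult[OF const_poly_carrier u(4), of c]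
            add[OF coord_ring_mult_closed[OF const_poly_carrier u(4), of c] carr[OF that]] by simp
        then show ?thesis
          unfolding set_eq_iff h.S.line_extension_mem_iff K_def by fastforce
      qed
      also have "\<dots> = \<pi> ` mp.span (set (u # us))"
        unfolding list.set mp.span_insert
        by (auto simp: image_iff) (metis add_diff_cancel_left' diff_add_cancel add.commute)+
      finally show ?thesis .
    qed
    ultimately show ?case by blast
  qed
  obtain us where us: "distinct us" "set us = C"
    using C(1) finite_distinct_list by blast
  \<comment> \<open>The component in the span of \<open>B\<close> lies in \<open>I\<close>, so
    dropping it does not change the coset.\<close>
  have "\<pi> ` mp.span C = \<pi> ` homog_part k n i"
  proof
    show "\<pi> ` homog_part k n i \<subseteq> \<pi> ` mp.span C"
    proof
      fix x assume "x \<in> \<pi> ` homog_part k n i"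
      then obtain f where f: "f \<in> homog_part k n i" "x = \<pi> f" by blast
      then obtain b c where bc: "f = b + c" "b \<in> mp.span B" "c \<in> mp.span C"
        using C(5) mp.span_Un[of B C] by auto
      have "b \<in> I"
        using bc(2) mp.span_minimal[OF B(2) subspace_ideal[OF I(1)]] by blast
      moreover have "c \<in> homog_part k n i"
        using bc(3) span[of C] by blast
      ultimately have "\<pi> f = \<pi> c"
        using eq_iff[of f c] bc(1) homog_part_carrier f(1) by fastforce
      then show "x \<in> \<pi> ` mp.span C" using f(2) bc(3) by blast
    qed
  qed (use span[of C] in blast)
  then have "h.S.dimension (card C) K (\<pi> ` homog_part k n i)"
    using *[OF us(1)] us h.S.dimension_independent[of K "map \<pi> us"] distinct_card[of us] by simp
  then show ?thesis
    using h.S.dimI[OF K] unfolding Q_def[symmetric] K_def[symmetric] over_def by blast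
qed

section \<open>Monomial bases of the graded pieces\<close>

lemma independent_monomials:
  "mp.independent ((\<lambda>t. Poly_Mapping.single t (1::'a::field)) ` T)"
proof
  assume "mp.dependent ((\<lambda>t. Poly_Mapping.single t (1::'a)) ` T)"
  then obtain t where
    t: "Poly_Mapping.single t (1::'a) \<in> mp.span ((\<lambda>t. Poly_Mapping.single t 1) ` T - {Poly_Mapping.single t 1})"
    by (auto simp: mp.dependent_def)
  have "Poly_Mapping.lookup (const_poly c * f) t = c * Poly_Mapping.lookup f t" for c :: 'a and f
    by (simp add: const_poly_def map.rep_eq when_def flip: mult_map_scale_conv_mult)
  \<comment> \<open>The polynomials with zero coefficient at \<open>t\<close> form a subspace that
    contains all the other monomials of the family, but not that of \<open>t\<close>.\<close>
  then have "mp.subspace {f :: 'a mpolynomial. Poly_Mapping.lookup f t = 0}"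
    by (intro mp.subspaceI) (auto simp: lookup_add)
  moreover have "(\<lambda>t. Poly_Mapping.single t 1) ` T - {Poly_Mapping.single t 1}
      \<subseteq> {f :: 'a mpolynomial. Poly_Mapping.lookup f t = 0}"
    by (auto simp: lookup_single when_def)
  ultimately have "Poly_Mapping.lookup (Poly_Mapping.single t (1::'a)) t = 0"
    using t mp.span_minimal by blast
  then show False by simp
qed

lemma span_monomials:
  fixes f :: "'a::field mpolynomial"
  assumes "Poly_Mapping.keys f \<subseteq> T"
  shows "f \<in> mp.span ((\<lambda>t. Poly_Mapping.single t 1) ` T)"
proof -
  have "Poly_Mapping.single t c = const_poly c * Poly_Mapping.single t 1" for t and c :: 'a
    by (simp add: const_poly_def mult_single)
  then have "Poly_Mapping.single t c \<in> mp.span ((\<lambda>t. Poly_Mapping.single t 1) ` T)"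
    if "t \<in> T" for t and c :: 'a
    using that by (metis mp.span_scale mp.span_base imageI)
  then have "(\<Sum>t\<in>Poly_Mapping.keys f. Poly_Mapping.single t (Poly_Mapping.lookup f t))
      \<in> mp.span ((\<lambda>t. Poly_Mapping.single t 1) ` T)"
    using assms by (intro mp.span_sum) blast
  then show ?thesis
    by (simp flip: poly_mapping_sum_single)
qed

lemma N_fun_pos: "0 < N_fun k n i"
  by (simp add: N_fun_def prod_pos_nat_iff)

lemma N_fun_mono:
  assumes "i \<le> j"
  shows "N_fun k n i \<le> N_fun k n j"
  unfolding N_fun_def
proof (rule prod_mono)
  fix l
  \<comment> \<open>With the lower index fixed at \<open>n l\<close> the binomial is monotone in its
    upper index; symmetry translates back.\<close>
  have "(n l + i l) choose (n l) \<le> (n l + j l) choose (n l)"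
    using assms by (intro binomial_right_mono) (simp add: le_fun_def)
  then show "0 \<le> (n l + i l) choose (i l) \<and> (n l + i l) choose (i l) \<le> (n l + j l) choose (j l)"
    using binomial_symmetric[of "n l" "n l + i l"] binomial_symmetric[of "n l" "n l + j l"] by simp
qed

text \<open>The monomials of degree \<open>i\<close> form one basis with \<open>N_fun k n i\<close>
  elements, and by exchange every other basis has the same size.\<close>

lemma basis_of_homog_part:
  fixes A :: "'a::field mpolynomial set"
  assumes i: "i \<in> multidegrees k" and A: "A \<subseteq> homog_part k n i" "mp.independent A"
    "homog_part k n i \<subseteq> mp.span A"
  shows "finite A" "card A = N_fun k n i"
proof -
  define T where "T = {t. Poly_Mapping.keys t \<subseteq> ring_vars k n \<and> mon_deg t = i}"
  define M where "M = (\<lambda>t. Poly_Mapping.single t (1::'a)) ` T"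
  have card_T: "card T = N_fun k n i"
    unfolding T_def by (rule card_monomials_of_degree[OF i])
  \<comment> \<open>Infinite sets have \<open>card\<close> 0, so a positive cardinality gives
    finiteness.\<close>
  then have "finite T" using N_fun_pos[of k n i] by (metis card_ge_0_finite)
  moreover have "inj_on (\<lambda>t. Poly_Mapping.single t (1::'a)) T"
    by (rule inj_onI) (metis keys_single singleton_inject zero_neq_one)
  ultimately have M: "finite M" "card M = N_fun k n i"
    using card_T by (simp_all add: M_def card_image)
  have "M \<subseteq> homog_part k n i"
    by (auto simp: M_def T_def homog_part_def carrier_coord_ring)
  moreover have "homog_part k n i \<subseteq> mp.span M"
    using span_monomials[of _ T]
    by (fastforce simp: M_def T_def homog_part_def carrier_coord_ring)
  ultimately have "A \<subseteq> mp.span M" "M \<subseteq> mp.span A"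
    using A by blast+
  moreover have "mp.independent M"
    unfolding M_def by (rule independent_monomials)
  ultimately show "finite A" "card A = N_fun k n i"
    using mp.independent_span_bound[OF M(1) A(2)] mp.independent_span_bound[of A M] M(2) by auto
qed

section \<open>Minimal multidegrees and the role of the excluded sets\<close>

lemma exists_min_elems_le:
  assumes "S \<subseteq> multidegrees k" "x \<in> S"
  shows "\<exists>i\<in>min_elems S. i \<le> x"
proof -
  \<comment> \<open>An element of least total degree among those below \<open>x\<close>; anything
    strictly below it would have smaller total degree.\<close>
  define y where "y = (ARG_MIN (\<lambda>y. \<Sum>l\<in>{1..k}. y l) y. y \<in> S \<and> y \<le> x)"
  have y: "y \<in> S" "y \<le> x"
    using arg_min_natI[of "\<lambda>y. y \<in> S \<and> y \<le> x" x "\<lambda>y. \<Sum>l\<in>{1..k}. y l"] assms(2)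
    unfolding y_def by auto
  have least: "(\<Sum>l\<in>{1..k}. y l) \<le> (\<Sum>l\<in>{1..k}. z l)" if "z \<in> S" "z \<le> x" for z
    using arg_min_nat_le[of "\<lambda>y. y \<in> S \<and> y \<le> x" z "\<lambda>y. \<Sum>l\<in>{1..k}. y l"] that
    unfolding y_def by auto
  have "z = y" if z: "z \<in> S" "z \<le> y" for z
  proof
    fix l
    show "z l = y l"
    proof (cases "l \<in> {1..k}")
      case True
      show ?thesis
      proof (rule ccontr)
        assume "z l \<noteq> y l"
        then have "z l < y l" using z(2) by (simp add: le_fun_def order_less_le)
        then have "(\<Sum>l\<in>{1..k}. z l) < (\<Sum>l\<in>{1..k}. y l)"
          using True z(2) by (intro sum_strict_mono_ex1) (auto simp: le_fun_def)
        then show False using least[OF z(1) order.trans[OF z(2) y(2)]] by simp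
      qed
    next
      case False
      moreover have "z \<in> multidegrees k" "y \<in> multidegrees k"
        using z(1) y(1) assms(1) by blast+
      ultimately show ?thesis by (simp add: multidegrees_def del: atLeastAtMost_iff)
    qed
  qed
  then show ?thesis
    using y by (auto simp: min_elems_def)
qed

text \<open>If N exceeded \<open>s\<close> at \<open>j - unit_deg l\<close>, some \<open>i\<close>
  in \<open>D_set k n s\<close> would lie below it. Since \<open>j\<close> is not in the excluded
  set of \<open>i\<close> and \<open>i l < j l\<close>, this forces
  \<open>j = i + unit_deg l\<close>, that is, \<open>l\<close> \<in>
  \<open>L_set k n s j\<close>.\<close>

lemma N_fun_le_of_DD_set:
  assumes j: "j \<in> DD_set k n s" and l: "l \<in> {1..k}" "0 < j l" "l \<notin> L_set k n s j"
  shows "N_fun k n (j - unit_deg l) \<le> s"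
proof (rule ccontr)
  assume *: "\<not> ?thesis"
  have jm: "j \<in> multidegrees k"
    using j by (auto simp: DD_set_def D_shift_def D_set_def min_elems_def multidegrees_def unit_deg_def)
  have eq: "(j - unit_deg l) + unit_deg l = j"
    using l(2) by (auto simp: fun_eq_iff unit_deg_def)
  have "j - unit_deg l \<in> {i \<in> multidegrees k. s < N_fun k n i}"
    using jm * by (auto simp: multidegrees_def)
  then obtain i where i: "i \<in> D_set k n s" "i \<le> j - unit_deg l"
    using exists_min_elems_le[of "{i \<in> multidegrees k. s < N_fun k n i}" k] unfolding D_set_def by blast
  have il: "i l < j l"
    using i(2) l(2) by (auto simp: le_fun_def unit_deg_def dest: spec[of _ l])
  have ij: "i \<le> j"
    using i(2) by (auto simp: le_fun_def intro: order.trans)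
  have "j \<notin> DD_excl k i"
    using j i(1) by (auto simp: DD_set_def)
  then obtain m where m: "j = i + unit_deg m"
    using jm ij il by (auto simp: DD_excl_def)
  then have "m = l"
    using il by (auto simp: unit_deg_def split: if_splits)
  then show False
    using i(1) l(1,3) m by (auto simp: L_set_def D_shift_def)
qed

section \<open>Points in generic position\<close>

text \<open>Rank-nullity: a basis of I_i is extended to one of the whole graded piece, and the added
  elements count the dimension in the quotient.\<close>

lemma basis_of_ideal_part:
  fixes I :: "'a::field mpolynomial set"
  assumes I: "ideal I (coord_ring k n)" "1 \<notin> I" and i: "i \<in> multidegrees k"
  shows "\<exists>B. finite B \<and> mp.independent B \<and> B \<subseteq> I \<inter> homog_part k n i \<and>
    I \<inter> homog_part k n i \<subseteq> mp.span B \<and>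
    card B + ring.dim (coord_ring k n Quot I) ((\<lambda>c. I +>\<^bsub>coord_ring k n\<^esub> const_poly c) ` UNIV)
      ((\<lambda>f. I +>\<^bsub>coord_ring k n\<^esub> f) ` homog_part k n i) = N_fun k n i"
proof -
  obtain B where B: "B \<subseteq> I \<inter> homog_part k n i" "mp.independent B" "I \<inter> homog_part k n i \<subseteq> mp.span B"
    using mp.maximal_independent_subset by blast
  then obtain A where A: "B \<subseteq> A" "A \<subseteq> homog_part k n i" "mp.independent A" "homog_part k n i \<subseteq> mp.span A"
    using mp.maximal_independent_subset_extend[of B "homog_part k n i"] by blast
  note fin = basis_of_homog_part[OF i A(2-4)]
  have BA: "B \<union> (A - B) = A" using A(1) by blast
  have "ring.dim (coord_ring k n Quot I) ((\<lambda>c. I +>\<^bsub>coord_ring k n\<^esub> const_poly c) ` UNIV)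
      ((\<lambda>f. I +>\<^bsub>coord_ring k n\<^esub> f) ` homog_part k n i) = card (A - B)"
    by (rule dim_quotient_homog_part[where B = B]) (use I B A fin(1) BA in auto)
  moreover have "finite B" "card B + card (A - B) = card A"
    using A(1) fin(1) by (auto simp: finite_subset card_Diff_subset card_mono)
  ultimately show ?thesis
    using B fin(2) by auto
qed

lemma vanishing_ideal_generators_carrier:
  "{f. (\<exists>i\<in>multidegrees k. f \<in> homog_part k n i) \<and> (\<forall>P\<in>pts. vanishes_at k f P)}
    \<subseteq> carrier (coord_ring k n)"
  by (auto simp: homog_part_def)

lemma ideal_vanishing_ideal: "ideal (vanishing_ideal k n pts) (coord_ring k n)"
  unfolding vanishing_ideal_def
  by (rule ring.genideal_ideal[OF ring_coord_ring vanishing_ideal_generators_carrier])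

text \<open>An ideal with homogeneous generators is graded.\<close>

lemma deg_proj_vanishing_ideal:
  assumes "f \<in> vanishing_ideal k n pts"
  shows "deg_proj S f \<in> vanishing_ideal k n pts"
proof -
  note D = ideal_coord_ringD[OF ideal_vanishing_ideal[of k n pts]]
  show ?thesis
    using assms[unfolded vanishing_ideal_def] vanishing_ideal_generators_carrier
  \<comment> \<open>\<open>S\<close> must vary, since multiplication by a monomial replaces it by a
    preimage.\<close>
  proof (induction arbitrary: S rule: Idl_coord_ring_induct)
    case (gen f)
    then obtain i where "f \<in> homog_part k n i" by blast
    moreover have "f \<in> vanishing_ideal k n pts"
      using gen ring.genideal_self[OF ring_coord_ring vanishing_ideal_generators_carrier]
      unfolding vanishing_ideal_def by blast
    ultimately show ?case
      using deg_proj_homog_part[of f k n i S] D(2) by (simp add: when_def)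
  qed (simp_all add: D deg_proj_add deg_proj_mult_single)
qed

text \<open>
  In the trivial quotient the Hilbert function would be \<open>0\<close>, but genericity makes it \<open>1\<close> in degree \<open>0\<close>;
  so there is no need to evaluate polynomials at the points.
\<close>

lemma one_notin_vanishing_ideal:
  assumes "generic_position k n pts" "finite pts" "pts \<noteq> {}"
  shows "1 \<notin> vanishing_ideal k n pts"
proof
  assume one: "1 \<in> vanishing_ideal k n pts"
  have "(\<lambda>f. vanishing_ideal k n pts +>\<^bsub>coord_ring k n\<^esub> f) ` homog_part k n 0 \<noteq> {}"
    using homog_part_zero by blast
  moreover have "(\<lambda>f. vanishing_ideal k n pts +>\<^bsub>coord_ring k n\<^esub> f) ` homog_part k n 0
      \<subseteq> carrier (coord_ring k n Quot vanishing_ideal k n pts)"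
    unfolding carrier_FactRing using homog_part_carrier by blast
  ultimately have "hilbert_fun k n pts 0 = 0"
    using dim_quotient_one_in_ideal[OF ideal_vanishing_ideal one] by (simp add: hilbert_fun_def)
  moreover have "0 \<in> multidegrees k" by (simp add: multidegrees_def)
  ultimately have "min (N_fun k n 0) (card pts) = 0"
    using assms(1) unfolding generic_position_def by force
  then show False
    using N_fun_pos[of k n 0] assms(2,3) by (simp add: min_def split: if_splits)
qed

text \<open>Genericity enters here: N - min(N, s) is the truncated difference, so I_i is zero
  wherever N is at most the number of points.\<close>

lemma generic_basis:
  assumes "generic_position k n pts" "finite pts" "pts \<noteq> {}" "i \<in> multidegrees k"
  shows "\<exists>B. finite B \<and> mp.independent B \<and> B \<subseteq> vanishing_ideal k n pts \<inter> homog_part k n i \<and>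
    vanishing_ideal k n pts \<inter> homog_part k n i \<subseteq> mp.span B \<and>
    card B = N_fun k n i - card pts"
proof -
  have "hilbert_fun k n pts i = min (N_fun k n i) (card pts)"
    using assms(1,4) by (simp add: generic_position_def)
  moreover obtain B where "finite B" "mp.independent B"
    "B \<subseteq> vanishing_ideal k n pts \<inter> homog_part k n i"
    "vanishing_ideal k n pts \<inter> homog_part k n i \<subseteq> mp.span B"
    "card B + hilbert_fun k n pts i = N_fun k n i"
    using basis_of_ideal_part[OF ideal_vanishing_ideal one_notin_vanishing_ideal[OF assms(1-3)] assms(4)]
    unfolding hilbert_fun_def Let_def by (elim exE conjE)
  moreover from calculation have "card B = N_fun k n i - card pts"
    by linarith
  ultimately show ?thesis by (intro exI[of _ B] conjI)
qed

section \<open>The multidegrees that enter the bound\<close>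

lemma D_setD:
  assumes "i \<in> D_set k n s"
  shows "i \<in> multidegrees k" "s < N_fun k n i"
    and "\<And>l. 0 < i l \<Longrightarrow> N_fun k n (i - unit_deg l) \<le> s"
proof -
  show i: "i \<in> multidegrees k" "s < N_fun k n i"
    using assms by (auto simp: D_set_def min_elems_def)
  fix l assume l: "0 < i l"
  have "(i - unit_deg l) l \<noteq> i l"
    using l by (simp add: unit_deg_def)
  then have "i - unit_deg l \<noteq> i" by (intro notI) (simp only:)
  moreover have "i - unit_deg l \<le> i" "i - unit_deg l \<in> multidegrees k"
    using i(1) by (auto simp: le_fun_def multidegrees_def)
  moreover have "i' = i" if "i' \<in> multidegrees k" "s < N_fun k n i'" "i' \<le> i" for i'
    using assms that unfolding D_set_def min_elems_def by blast
  ultimately show "N_fun k n (i - unit_deg l) \<le> s"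
    using linorder_not_le by blast
qed

lemma DD_setE:
  assumes "j \<in> DD_set k n s"
  obtains i l where "i \<in> D_set k n s" "l \<in> {1..k}" "j = i + unit_deg l"
proof -
  obtain l where l: "l \<in> {1..k}" "j \<in> D_shift k n s l"
    using assms unfolding DD_set_def by blast
  obtain i where "j = i + unit_deg l" "i \<in> D_set k n s"
    using l(2) unfolding D_shift_def by (rule imageE)
  with l(1) show thesis by (intro that)
qed

text \<open>Some predecessor of \<open>j\<close> lies in \<open>D_set k n s\<close> and has N
  greater than \<open>s\<close>, while all predecessors of a minimal degree have N at most
  \<open>s\<close>. So the two index sets are disjoint and their sums can be combined.\<close>

lemma DD_setD:
  assumes "j \<in> DD_set k n s"
  shows "j \<in> multidegrees k" "s < N_fun k n j" "j \<notin> D_set k n s"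
proof -
  obtain i l where il: "i \<in> D_set k n s" "l \<in> {1..k}" "j = i + unit_deg l"
    using assms by (rule DD_setE)
  have le: "i \<le> j" using il(3) by (simp add: le_fun_def)
  show "j \<in> multidegrees k"
    using D_setD(1)[OF il(1)] il by (auto simp: multidegrees_def unit_deg_def)
  show "s < N_fun k n j"
    using N_fun_mono[OF le] D_setD(2)[OF il(1)] by (rule order.strict_trans2[rotated])
  have "j - unit_deg l = i"
    by (simp add: il(3))
  then show "j \<notin> D_set k n s"
    using D_setD(3)[of j k n s l] D_setD(2)[OF il(1)] il(3) by (auto simp: unit_deg_def)
qed

section \<open>The lower bound for the number of generators\<close>

theorem theorem5p2:
  fixes k s :: nat and n :: "nat \<Rightarrow> nat"
    and pts :: "(nat \<Rightarrow> (nat \<Rightarrow> 'a::{alg_closed_field, field_char_0}) set) set"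
  assumes "k \<ge> 1"
    and "\<forall>l\<in>{1..k}. n l \<ge> 1"
    and "pts \<subseteq> multiproj_space k n" and "finite pts" and "pts \<noteq> {}" and "card pts = s"
    and "generic_position k n pts"
    and "nondegenerate k n pts"
  shows "min_num_gens (coord_ring k n) (vanishing_ideal k n pts) \<ge> enat (nat (v_bound k n s))"
  unfolding min_num_gens_def
proof (rule INF_greatest)
  let ?I = "vanishing_ideal k n pts"
  let ?N = "N_fun k n" and ?D = "D_set k n s" and ?DD = "DD_set k n s"
  fix G :: "'a mpolynomial set"
  assume "G \<in> {G. finite G \<and> G \<subseteq> carrier (coord_ring k n) \<and> Idl\<^bsub>coord_ring k n\<^esub> G = ?I}"
  then have G: "finite G" "G \<subseteq> carrier (coord_ring k n)" "Idl\<^bsub>coord_ring k n\<^esub> G = ?I"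
    by auto
  have "\<forall>i. \<exists>B. i \<in> multidegrees k \<longrightarrow> finite B \<and> mp.independent B \<and> B \<subseteq> ?I \<inter> homog_part k n i \<and>
      ?I \<inter> homog_part k n i \<subseteq> mp.span B \<and> card B = ?N i - s"
    using generic_basis[OF assms(7,4,5)] assms(6) by blast
  then obtain B where B: "finite (B i)" "mp.independent (B i)" "B i \<subseteq> ?I \<inter> homog_part k n i"
      "?I \<inter> homog_part k n i \<subseteq> mp.span (B i)" and card_B: "card (B i) = ?N i - s"
    if "i \<in> multidegrees k" for i
    by metis
  \<comment> \<open>The bound for the dimension of W_j; by truncation, predecessors with N at most
    \<open>s\<close> contribute 0.\<close>
  define c where "c j = (\<Sum>l\<in>{l\<in>{1..k}. 0 < j l}. (n l + 1) * (?N (j - unit_deg l) - s))" for j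
  have bound: "(\<Sum>j\<in>F. ?N j - s) \<le> card G + (\<Sum>j\<in>F. c j)"
    if F: "finite F" "F \<subseteq> multidegrees k" for F
  proof -
    have "j - unit_deg l \<in> multidegrees k" if "j \<in> F" for j l
      using F(2) that by (auto simp: multidegrees_def)
    then have "(\<Sum>j\<in>F. c j) =
        (\<Sum>j\<in>F. \<Sum>l\<in>{l\<in>{1..k}. 0 < j l}. (n l + 1) * card (B (j - unit_deg l)))"
      by (simp add: c_def card_B)
    moreover have "(\<Sum>j\<in>F. ?N j - s) = (\<Sum>j\<in>F. card (B j))"
      using F(2) by (intro sum.cong) (auto simp: card_B)
    ultimately show ?thesis
      using sum_card_basis_le[OF ideal_vanishing_ideal deg_proj_vanishing_ideal G F B] by simp
  qed
  \<comment> \<open>By minimality the ideal is zero in every predecessor of \<open>i\<close>, so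
    nothing in degree \<open>i\<close> comes from below.\<close>
  have c_D: "c i = 0" if "i \<in> ?D" for i
    using D_setD(3)[OF that] by (simp add: c_def)
  \<comment> \<open>Indices outside \<open>L_set k n s j\<close> contribute 0, and for those inside
    N exceeds \<open>s\<close>, so truncated and integer differences agree.\<close>
  have c_DD: "int (c j) = (\<Sum>l\<in>L_set k n s j. int (n l + 1) * (int (?N (j - unit_deg l)) - int s))"
    if "j \<in> ?DD" for j
  proof -
    have L: "0 < j l" "s \<le> ?N (j - unit_deg l)" if l: "l \<in> L_set k n s j" for l
    proof -
      obtain i where i: "i \<in> ?D" "j = i + unit_deg l"
        using l by (auto simp: L_set_def D_shift_def)
      then show "0 < j l" by (simp add: unit_deg_def)
      have "j - unit_deg l = i"
        by (simp add: i(2))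
      then show "s \<le> ?N (j - unit_deg l)"
        using D_setD(2)[OF i(1)] by simp
    qed
    have "c j = (\<Sum>l\<in>L_set k n s j. (n l + 1) * (?N (j - unit_deg l) - s))"
      unfolding c_def
    proof (rule sum.mono_neutral_right)
      show "L_set k n s j \<subseteq> {l \<in> {1..k}. 0 < j l}"
        using L(1) by (auto simp: L_set_def)
      show "\<forall>l\<in>{l \<in> {1..k}. 0 < j l} - L_set k n s j. (n l + 1) * (?N (j - unit_deg l) - s) = 0"
        using N_fun_le_of_DD_set[OF that] by simp
    qed simp
    moreover have "int (?N (j - unit_deg l) - s) = int (?N (j - unit_deg l)) - int s"
      if "l \<in> L_set k n s j" for l
      using L(2)[OF that] by (rule of_nat_diff)
    ultimately show ?thesis
      by (simp only: of_nat_sum of_nat_mult cong: sum.cong)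
  qed
  have finite_D: "finite ?D"
  proof (rule ccontr)
    assume "infinite ?D"  \<comment> \<open>each degree in \<open>?D\<close> requires a generator of its own\<close>
    then obtain F where F: "F \<subseteq> ?D" "finite F" "card F = Suc (card G)"
      using infinite_arbitrarily_large by blast
    have "card F \<le> (\<Sum>j\<in>F. ?N j - s)"
      using sum_mono[of F "\<lambda>_. 1" "\<lambda>j. ?N j - s"] D_setD(2) F(1) by (force simp: Suc_le_eq)
    also have "\<dots> \<le> card G"
    proof -
      have "F \<subseteq> multidegrees k" using F(1) D_setD(1) by blast
      moreover have "(\<Sum>j\<in>F. c j) = 0" using F(1) c_D by (intro sum.neutral) blast
      ultimately show ?thesis using bound[OF F(2)] by simp
    qed
    finally show False using F(3) by simp
  qed
  have finite_DD: "finite ?DD"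
    using finite_D by (simp add: DD_set_def D_shift_def)
  \<comment> \<open>The degrees where the maximum in \<open>v_bound\<close> is positive; keeping the
    others in the count could only weaken the estimate.\<close>
  define E where "E = {j \<in> ?DD. c j < ?N j - s}"
  have E: "finite E" "E \<subseteq> ?DD" "?D \<inter> E = {}"
    using finite_DD DD_setD(3) by (auto simp: E_def)
  have "int (\<Sum>j\<in>?D \<union> E. ?N j - s) \<le> int (card G + (\<Sum>j\<in>?D \<union> E. c j))"
    using bound[of "?D \<union> E"] finite_D E(1,2) D_setD(1) DD_setD(1) by (simp only: of_nat_le_iff) blast
  moreover have "int (\<Sum>j\<in>?D \<union> E. ?N j - s) = (\<Sum>i\<in>?D. int (?N i) - int s) + (\<Sum>j\<in>E. int (?N j) - int s)"
  proof -
    have "int (?N j - s) = int (?N j) - int s" if "j \<in> ?D \<union> E" for j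
      using that D_setD(2) DD_setD(2) E(2) by (intro of_nat_diff) (blast intro: less_imp_le)
    then show ?thesis
      by (simp add: sum.union_disjoint[OF finite_D E(1,3)])
  qed
  moreover have "(\<Sum>j\<in>?D \<union> E. c j) = (\<Sum>j\<in>E. c j)"
    using c_D by (simp add: sum.union_disjoint[OF finite_D E(1,3)])
  moreover have "(\<Sum>j\<in>?DD. max 0 (int (?N j) - int s -
      (\<Sum>l\<in>L_set k n s j. int (n l + 1) * (int (?N (j - unit_deg l)) - int s)))) =
      (\<Sum>j\<in>E. int (?N j) - int s - int (c j))"
  proof -
    \<comment> \<open>Outside \<open>E\<close> the maximum is 0; on \<open>E\<close> it is its
      second argument.\<close>
    have "(\<Sum>j\<in>?DD. max 0 (int (?N j) - int s - int (c j))) = (\<Sum>j\<in>E. max 0 (int (?N j) - int s - int (c j)))"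
      using finite_DD by (intro sum.mono_neutral_right) (auto simp: E_def)
    also have "\<dots> = (\<Sum>j\<in>E. int (?N j) - int s - int (c j))"
      by (intro sum.cong) (auto simp: E_def)
    finally show ?thesis
      by (simp only: c_DD cong: sum.cong)
  qed
  ultimately have "v_bound k n s \<le> int (card G)"
    unfolding v_bound_def by (simp add: sum_subtractf)
  then show "enat (nat (v_bound k n s)) \<le> enat (card G)"
    by simp
qed

end
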